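(* Let $A$ be an evolution $\mathbb{K}$-algebra with natural basis $B$ and associated directed graph $E$ relative to $B$, and let $H\subset E^0$ be a hereditary subset. If the ideal $I_H$ has the absorption property, then $H$ is a saturated set.
   Context: An evolution algebra over a field $\mathbb{K}$ is a (not necessarily associative or finite-dimensional) $\mathbb{K}$-algebra $A$ having a basis $B=\{e_i\}_{i\in\Lambda}$, called a natural basis, with $e_ie_j=0$ whenever $i\neq j$. The associated directed graph $E$ relative to $B$ has vertex set $E^0=B$ and exactly one edge from $e_i$ to $e_j$ if the coefficient of $e_j$ in $e_i^2$ is nonzero, and no edge otherwise; $s(f)$, $r(f)$ denote the source and range of an edge $f$. A subset $H\subset E^0$ is hereditary if, for every $u\in H$, every vertex reachable from $u$ by a directed path belongs to $H$. A vertex $u$ is regular if $0<|s^{-1}(u)|<\infty$. $H$ is saturated if for every regular vertex $u\in E^0$, $r(s^{-1}(u))\subset H$ implies $u\in H$. For a hereditary $H$, $I_H:=\operatorname{span}(H)$ (an ideal of $A$), with $I_\emptyset=\{0\}$. An ideal $I$ of a commutative algebra $A$ has the absorption property if $xA\subset I$ implies $x\in I$. *)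

theory Defs
  imports Complex_Main "Graph_Theory.Digraph"
begin

locale nonassoc_algebra = vector_space scale
  for scale :: "'k::field \<Rightarrow> 'a::ab_group_add \<Rightarrow> 'a"  (infixr \<open>*s\<close> 75) +
  fixes mult :: "'a \<Rightarrow> 'a \<Rightarrow> 'a"  (infixl \<open>\<bullet>\<close> 70)
  assumes linear_mult_right: "\<And>x. Vector_Spaces.linear scale scale (\<lambda>y. x \<bullet> y)"
    and linear_mult_left: "\<And>y. Vector_Spaces.linear scale scale (\<lambda>x. x \<bullet> y)"
begin

definition algebra_ideal :: "'a set \<Rightarrow> bool" where
  "algebra_ideal I \<longleftrightarrow> subspace I \<and> (\<forall>x\<in>I. \<forall>a. x \<bullet> a \<in> I \<and> a \<bullet> x \<in> I)"

definition natural_basis :: "'a set \<Rightarrow> bool" where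
  "natural_basis B \<longleftrightarrow> independent B \<and> span B = UNIV \<and>
    (\<forall>u\<in>B. \<forall>v\<in>B. u \<noteq> v \<longrightarrow> u \<bullet> v = 0)"

text \<open>The arcs are pairs of basis vectors, so there is at most one arc from \<open>u\<close> to \<open>v\<close>.\<close>

definition evolution_graph :: "'a set \<Rightarrow> ('a, 'a \<times> 'a) pre_digraph" where
  "evolution_graph B =
    \<lparr> verts = B,
      arcs = {(u, v). u \<in> B \<and> v \<in> B \<and> representation B (u \<bullet> u) v \<noteq> 0},
      tail = fst, head = snd \<rparr>"

text \<open>Absorption is used for ideals of commutative algebras, where the side on which
  \<open>x\<close> acts is irrelevant. An algebra with a natural basis is commutative.\<close>

definition absorption_property :: "'a set \<Rightarrow> bool" where
  "absorption_property I \<longleftrightarrow> (\<forall>x. (\<forall>a. x \<bullet> a \<in> I) \<longrightarrow> x \<in> I)"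

end

text \<open>The three notions below are meant for vertices and sets of vertices of a digraph;
  \<open>H \<subseteq> verts G\<close> is not part of the definitions.\<close>

definition hereditary :: "('v, 'e) pre_digraph \<Rightarrow> 'v set \<Rightarrow> bool" where
  "hereditary G H \<longleftrightarrow> (\<forall>u\<in>H. \<forall>v. reachable G u v \<longrightarrow> v \<in> H)"

definition regular_vertex :: "('v, 'e) pre_digraph \<Rightarrow> 'v \<Rightarrow> bool" where
  "regular_vertex G u \<longleftrightarrow> u \<in> verts G \<and> finite (out_arcs G u) \<and> 0 < card (out_arcs G u)"

definition saturated :: "('v, 'e) pre_digraph \<Rightarrow> 'v set \<Rightarrow> bool" where
  "saturated G H \<longleftrightarrow> (\<forall>u. regular_vertex G u \<and> head G ` out_arcs G u \<subseteq> H \<longrightarrow> u \<in> H)"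

locale evolution_algebra = nonassoc_algebra +
  fixes B :: "'b set"
  assumes natural_basis: "natural_basis B"
begin

abbreviation E :: "('b, 'b \<times> 'b) pre_digraph" where
  "E \<equiv> evolution_graph B"

lemma mult_commute: "x \<bullet> y = y \<bullet> x"
proof -
  have r: "module_hom scale scale (\<lambda>y. x \<bullet> y)" and l: "module_hom scale scale (\<lambda>x. x \<bullet> y)" for x y
    using linear_mult_right linear_mult_left by (auto simp: module_hom_iff_linear)
  have 1: "u \<bullet> v = v \<bullet> u" if "u \<in> B" "v \<in> B" for u v
    using natural_basis that unfolding natural_basis_def by metis
  have U: "span B = UNIV" using natural_basis natural_basis_def by blast
  interpret P: module_pair scale scale ..
  have 2: "u \<bullet> y = y \<bullet> u" if "u \<in> B" for u y
    by (rule P.module_hom_eq_on_span[OF r l, of B]) (use 1 that U in auto)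
  show ?thesis
    by (rule P.module_hom_eq_on_span[OF l r, of B]) (use 2 U in auto)
qed

lemma square_in_span:
  assumes u: "u \<in> B" and N: "\<And>v. (u, v) \<in> arcs E \<Longrightarrow> v \<in> H"
  shows "u \<bullet> u \<in> span H"
proof -
  have "(\<Sum>b | representation B (u \<bullet> u) b \<noteq> 0. representation B (u \<bullet> u) b *s b) = u \<bullet> u"
    using natural_basis by (intro sum_nonzero_representation_eq) (auto simp: natural_basis_def)
  moreover have "(\<Sum>b | representation B (u \<bullet> u) b \<noteq> 0. representation B (u \<bullet> u) b *s b) \<in> span H"
    using u by (intro span_sum span_scale span_base N)
      (auto simp: evolution_graph_def dest: representation_ne_zero)
  ultimately show ?thesis by simp
qed

lemma vertex_mult_in_span:
  assumes u: "u \<in> B" and N: "\<And>v. (u, v) \<in> arcs E \<Longrightarrow> v \<in> H"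
  shows "u \<bullet> a \<in> span H"
proof -
  have r: "module_hom scale scale (\<lambda>y. u \<bullet> y)"
    using linear_mult_right by (auto simp: module_hom_iff_linear)
  have "a \<in> span B" using natural_basis natural_basis_def by blast
  then show ?thesis
  proof (induction rule: span_induct)
    case base
    show ?case
      by (auto simp: subspace_def module_hom.add[OF r] module_hom.scale[OF r] module_hom.zero[OF r]
          span_add span_scale span_zero)
  next
    case (step v)
    show ?case
      using natural_basis square_in_span[OF u N] u step
      by (cases "v = u") (auto simp: natural_basis_def span_zero)
  qed
qed

lemma algebra_ideal_span:
  assumes "H \<subseteq> verts E" and her: "hereditary E H"
  shows "algebra_ideal (span H)"
proof -
  have HB: "H \<subseteq> B" using assms by (simp add: evolution_graph_def)
  have l: "module_hom scale scale (\<lambda>x. x \<bullet> a)" for a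
    using linear_mult_left by (auto simp: module_hom_iff_linear)
  have *: "x \<bullet> a \<in> span H" if "x \<in> span H" for x a
    using that
  proof (induction rule: span_induct)
    case base
    show ?case
      by (auto simp: subspace_def module_hom.add[OF l] module_hom.scale[OF l] module_hom.zero[OF l]
          span_add span_scale span_zero)
  next
    case (step u)
    show ?case
    proof (rule vertex_mult_in_span)
      show "u \<in> B" using step HB by blast
      fix v assume uv: "(u, v) \<in> arcs E"
      then have "u \<in> verts E" "v \<in> verts E" "(u, v) \<in> arcs_ends E"
        by (force simp: evolution_graph_def arcs_ends_def arc_to_ends_def)+
      then have "reachable E u v"
        unfolding reachable_def by (meson rtrancl_on_refl rtrancl_on_into_rtrancl_on)
      then show "v \<in> H" using her step unfolding hereditary_def by blast
    qed
  qed
  moreover have "a \<bullet> x \<in> span H" if "x \<in> span H" for x a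
    using *[OF that, of a] by (subst mult_commute)
  ultimately show ?thesis
    unfolding algebra_ideal_def by (intro conjI ballI allI subspace_span)
qed

end

end

theory Submission
  imports Defs
begin

text \<open>If every arc that starts at \<open>u\<close> ends in \<open>H\<close>, then \<open>u \<bullet> u\<close> lies in \<open>span H\<close>. Since \<open>u\<close>
  annihilates every other basis vector, all products \<open>u \<bullet> a\<close> are multiples of \<open>u \<bullet> u\<close>,
  so they lie in \<open>span H\<close> as well (\<open>vertex_mult_in_span\<close>). Absorption then puts \<open>u\<close> itself
  into \<open>span H\<close>. As \<open>B\<close> is independent, no vertex outside \<open>H\<close> is a linear combination of
  vertices in \<open>H\<close>, and therefore \<open>u \<in> H\<close>.\<close>

lemma (in vector_space) independent_mem_span_subset_iff:
  assumes "independent B" "H \<subseteq> B" "u \<in> B"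
  shows "u \<in> span H \<longleftrightarrow> u \<in> H"
proof
  assume u: "u \<in> span H"
  show "u \<in> H"
  proof (rule ccontr)
    assume "u \<notin> H"
    then have "u \<in> span (B - {u})"
      using u assms(2) span_mono[of H "B - {u}"] by blast
    then show False
      using assms(1,3) dependent_def by blast
  qed
qed (rule span_base)

theorem proposition5p4:
  fixes scale :: "'k::field \<Rightarrow> 'a::ab_group_add \<Rightarrow> 'a"
    and mult :: "'a \<Rightarrow> 'a \<Rightarrow> 'a"
    and B H :: "'a set"
  assumes "evolution_algebra scale mult B"
    and "H \<subseteq> verts (nonassoc_algebra.evolution_graph scale mult B)"
    and "hereditary (nonassoc_algebra.evolution_graph scale mult B) H"
    and "nonassoc_algebra.absorption_property mult (module.span scale H)"
  shows "saturated (nonassoc_algebra.evolution_graph scale mult B) H"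
proof -
  interpret evolution_algebra scale mult B by (fact assms(1))
  have HB: "H \<subseteq> B"
    using assms(2) by (simp add: evolution_graph_def)
  show ?thesis
    unfolding saturated_def
  proof (intro allI impI)
    fix u
    assume u: "regular_vertex E u \<and> head E ` out_arcs E u \<subseteq> H"
    then have uB: "u \<in> B"
      by (simp add: regular_vertex_def evolution_graph_def)
    have "v \<in> H" if "(u, v) \<in> arcs E" for v
    proof -
      have "(u, v) \<in> out_arcs E u" "head E (u, v) = v"
        using that by (simp_all add: out_arcs_def evolution_graph_def)
      then show ?thesis
        using u by (metis image_subset_iff)
    qed
    then have "mult u a \<in> span H" for a
      using vertex_mult_in_span uB by blast
    then have "u \<in> span H"
      using assms(4) unfolding absorption_property_def by blast
    then show "u \<in> H"
      using independent_mem_span_subset_iff HB uB natural_basis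
      unfolding natural_basis_def by blast
  qed
qed

end
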